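(* $\mathsf{COH}\le_\mathrm{sW}\mathsf{wRSg}$.
   Context: Problems are multi-valued partial functions $\subseteq\omega^\omega\rightrightarrows\omega^\omega$ with standard codings. $\mathcal{F}\le_\mathrm{sW}\mathcal{G}$ if there are Turing functionals $\Phi,\Psi$ with $\Phi(f)\in\mathrm{dom}(\mathcal{G})$ for all $f\in\mathrm{dom}(\mathcal{F})$ and $\Psi(g)\in\mathcal{F}(f)$ for all $f\in\mathrm{dom}(\mathcal F)$, $g\in\mathcal{G}(\Phi(f))$. $\mathsf{COH}$: input a sequence $(A_i:i\in\omega)$ of subsets of $\omega$; output an infinite $C\subseteq\omega$ such that for each $i$, $C\setminus A_i$ is finite or $C\cap A_i$ is finite. Graphs $G=(V,E)$ are simple with $V\subseteq\omega$ infinite, $E\subseteq[V]^2$; $N(v)=\{y:(v,y)\in E\}$. $\mathsf{wRSg}$: input an infinite graph $G=(V,E)$; output an infinite $H\subseteq V$ with, for all $v\in H$, $|H\cap N(v)|=\omega$ or $|H\cap N(v)|\le1$. *)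

theory Defs
  imports Complex_Main "HOL-Library.Nat_Bijection" "HOL-Library.Ramsey"
begin

text \<open>
  Turing functionals are presented by Kleene's schemes for the partial recursive functions
  relative to an oracle. Programs carry no arity; an ill-typed application (too few arguments)
  diverges.
\<close>

datatype program =
    Zero
  | Succ
  | Proj nat
  | Oracle
  | Comp program "program list"
  | PrimRec program program
  | Mu program

text \<open>
  In the equation for \<open>Comp\<close>, \<open>those\<close> returns \<open>None\<close> if one of the inner computations diverges.
  In the equation for \<open>Mu\<close>, all values below the least zero have to be defined.
\<close>

fun eval :: "(nat \<Rightarrow> nat) \<Rightarrow> program \<Rightarrow> nat list \<Rightarrow> nat option" where
  "eval f Zero xs = Some 0"
| "eval f Succ xs = (case xs of [] \<Rightarrow> None | x # _ \<Rightarrow> Some (Suc x))"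
| "eval f (Proj i) xs = (if i < length xs then Some (xs ! i) else None)"
| "eval f Oracle xs = (case xs of [] \<Rightarrow> None | x # _ \<Rightarrow> Some (f x))"
| "eval f (Comp p qs) xs =
    (case those (map (\<lambda>q. eval f q xs) qs) of None \<Rightarrow> None | Some ys \<Rightarrow> eval f p ys)"
| "eval f (PrimRec p q) xs =
    (case xs of
      [] \<Rightarrow> None
    | n # zs \<Rightarrow>
        rec_nat (eval f p zs)
          (\<lambda>m r. case r of None \<Rightarrow> None | Some y \<Rightarrow> eval f q (m # y # zs)) n)"
| "eval f (Mu p) xs =
    (if \<exists>n. eval f p (n # xs) = Some 0 \<and> (\<forall>m<n. eval f p (m # xs) \<noteq> None)
     then Some (LEAST n. eval f p (n # xs) = Some 0)
     else None)"

definition turing_functional :: "((nat \<Rightarrow> nat) \<Rightarrow> nat \<rightharpoonup> nat) \<Rightarrow> bool" where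
  "turing_functional \<Phi> \<longleftrightarrow> (\<exists>p. \<forall>f n. \<Phi> f n = eval f p [n])"

text \<open>A problem maps each instance to the set of its solutions, and non-instances to the empty set.\<close>

type_synonym problem = "(nat \<Rightarrow> nat) \<Rightarrow> (nat \<Rightarrow> nat) set"

definition pdom :: "problem \<Rightarrow> (nat \<Rightarrow> nat) set" where
  "pdom F = {f. F f \<noteq> {}}"

text \<open>\<open>\<Phi> f = Some \<circ> g\<close> says that \<open>\<Phi>(f)\<close> is total, with value \<open>g\<close>.\<close>

definition sW_reducible :: "problem \<Rightarrow> problem \<Rightarrow> bool"  (infix \<open>\<le>\<^sub>s\<^sub>W\<close> 50) where
  "F \<le>\<^sub>s\<^sub>W G \<longleftrightarrow>
    (\<exists>\<Phi> \<Psi>. turing_functional \<Phi> \<and> turing_functional \<Psi> \<and>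
      (\<forall>f \<in> pdom F. \<exists>g \<in> pdom G. \<Phi> f = Some \<circ> g \<and>
        (\<forall>h \<in> G g. \<exists>k \<in> F f. \<Psi> h = Some \<circ> k)))"

definition char_fun :: "nat set \<Rightarrow> nat \<Rightarrow> nat" where
  "char_fun A n = of_bool (n \<in> A)"

definition join :: "(nat \<Rightarrow> nat) \<Rightarrow> (nat \<Rightarrow> nat) \<Rightarrow> nat \<Rightarrow> nat" where
  "join f g n = (if even n then f (n div 2) else g (n div 2))"

definition seq_code :: "(nat \<Rightarrow> nat set) \<Rightarrow> nat \<Rightarrow> nat" where
  "seq_code A = char_fun {prod_encode (i, n) | i n. n \<in> A i}"

definition COH :: problem where
  "COH f =
    {char_fun C | C A. f = seq_code A \<and> infinite C \<and>
      (\<forall>i. finite (C - A i) \<or> finite (C \<inter> A i))}"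

text \<open>Edges are two-element sets of vertices; the edge set is coded as a symmetric set of pairs.\<close>

definition inf_graph :: "nat set \<Rightarrow> nat set set \<Rightarrow> bool" where
  "inf_graph V E \<longleftrightarrow> infinite V \<and> E \<subseteq> [V]\<^bsup>2\<^esup>"

definition nbhd :: "nat set set \<Rightarrow> nat \<Rightarrow> nat set" where
  "nbhd E v = {y. {v, y} \<in> E}"

definition graph_code :: "nat set \<Rightarrow> nat set set \<Rightarrow> nat \<Rightarrow> nat" where
  "graph_code V E = join (char_fun V) (char_fun {prod_encode (x, y) | x y. {x, y} \<in> E})"

definition wRSg :: problem where
  "wRSg g =
    {char_fun H | H V E. inf_graph V E \<and> g = graph_code V E \<and> infinite H \<and> H \<subseteq> V \<and>
      (\<forall>v \<in> H. infinite (H \<inter> nbhd E v) \<or> card (H \<inter> nbhd E v) \<le> 1)}"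

end

theory Submission
  imports Defs "HOL-Library.Discrete_Functions"
begin

text \<open>
  Given sets \<open>A\<^sub>0, A\<^sub>1, \<dots>\<close>, represent \<open>x\<close> by the number \<open>v\<close> with binary numeral
  \<open>1 A\<^sub>0(x) \<dots> A\<^bsub>x-1\<^esub>(x)\<close>, and let the significand \<open>r(v) = v / 2\<^sup>x\<close> be the dyadic rational obtained
  by placing the binary point after the leading digit. Join \<open>u < v\<close> by an edge iff \<open>r(u) < r(v)\<close>.
  A set along which \<open>r\<close> is eventually monotone yields a cohesive set, because every truncation of
  \<open>r\<close> stabilises along it.

  Let \<open>S\<close> be a solution of this graph, and call \<open>d \<in> S\<close> a hub if it has two smaller neighbours in
  \<open>S\<close>; a hub has infinitely many neighbours in \<open>S\<close>. If there is no hub, then at most one element of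
  \<open>S\<close> has infinitely many neighbours in \<open>S\<close>, so that for each other \<open>y \<in> S\<close> we have \<open>r(z) \<le> r(y)\<close>
  for almost all \<open>z \<in> S\<close>, and \<open>S\<close> itself is such a set. If \<open>d\<close> is the first hub, then every later
  \<open>x \<in> S\<close> with \<open>r(x) > r(d)\<close> is a hub as well, so the successive strict maxima of \<open>r\<close> on \<open>S\<close> from
  \<open>d\<close> on never end. A single procedure handles both cases: it keeps the elements of \<open>S\<close> at which \<open>r\<close>
  exceeds all its values on \<open>S\<close> between the first hub and that element. The reduction is strong
  because \<open>x\<close> and \<open>r(v)\<close> are computable from \<open>v\<close> alone.
\<close>

section \<open>Total computable functionals\<close>

definition computable :: "nat \<Rightarrow> ((nat \<Rightarrow> nat) \<Rightarrow> nat list \<Rightarrow> nat) \<Rightarrow> bool" where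
  "computable k F \<longleftrightarrow> (\<exists>p. \<forall>f xs. length xs = k \<longrightarrow> eval f p xs = Some (F f xs))"

abbreviation decidable :: "nat \<Rightarrow> ((nat \<Rightarrow> nat) \<Rightarrow> nat list \<Rightarrow> bool) \<Rightarrow> bool" where
  "decidable k P \<equiv> computable k (\<lambda>f xs. of_bool (P f xs))"

lemma computableI: "(\<And>f xs. length xs = k \<Longrightarrow> eval f p xs = Some (F f xs)) \<Longrightarrow> computable k F"
  unfolding computable_def by blast

lemma computableE:
  assumes "computable k F"
  obtains p where "\<And>f xs. length xs = k \<Longrightarrow> eval f p xs = Some (F f xs)"
  using assms unfolding computable_def by blast

lemma those_map_Some: "those (map Some xs) = Some xs"
  by (induction xs) auto

lemma computable_subst:
  assumes F: "computable (length gs + k) F" and gs: "\<And>g. g \<in> set gs \<Longrightarrow> computable (n + k) g"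
  shows "computable (n + k) (\<lambda>f xs. F f (map (\<lambda>g. g f xs) gs @ drop n xs))"
proof -
  obtain p where p: "\<And>f xs. length xs = length gs + k \<Longrightarrow> eval f p xs = Some (F f xs)"
    using F by (rule computableE) blast
  obtain q where q: "\<And>g f xs. g \<in> set gs \<Longrightarrow> length xs = n + k \<Longrightarrow> eval f (q g) xs = Some (g f xs)"
    using gs unfolding computable_def by metis
  have "eval f (Comp p (map q gs @ map Proj [n..<n + k])) xs =
      Some (F f (map (\<lambda>g. g f xs) gs @ drop n xs))" if len: "length xs = n + k" for f xs
  proof -
    have "map (\<lambda>p. eval f p xs) (map q gs @ map Proj [n..<n + k]) =
        map Some (map (\<lambda>g. g f xs) gs @ drop n xs)"
      by (auto simp: q len intro: nth_equalityI)
    then show ?thesis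
      by (simp add: those_map_Some p len del: map_append map_map)
  qed
  then show ?thesis by (rule computableI)
qed

lemma computable_subst_hd:
  assumes "computable (Suc k) F" "computable k a"
  shows "computable k (\<lambda>f xs. F f (a f xs # xs))"
  using computable_subst[of "[a]" k F 0] assms by simp

lemma computable_comp1:
  assumes "computable (Suc 0) (\<lambda>f xs. g f (hd xs))" "computable k a"
  shows "computable k (\<lambda>f xs. g f (a f xs))"
  using computable_subst[of "[a]" 0 "\<lambda>f xs. g f (hd xs)" k] assms by simp

lemma computable_comp2:
  assumes "computable (Suc (Suc 0)) (\<lambda>f xs. g f (hd xs) (hd (tl xs)))"
    and "computable k a" "computable k b"
  shows "computable k (\<lambda>f xs. g f (a f xs) (b f xs))"
  using computable_subst[of "[a, b]" 0 "\<lambda>f xs. g f (hd xs) (hd (tl xs))" k] assms by auto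

named_theorems computable_intros

lemma computable_hd: "computable (Suc k) (\<lambda>f xs. hd xs)"
  by (rule computableI[of _ "Proj 0"]) (auto simp: length_Suc_conv)

lemma computable_tl:
  assumes "computable k F"
  shows "computable (Suc k) (\<lambda>f xs. F f (tl xs))"
  using computable_subst[of "[]" k F "Suc 0"] assms by (simp add: drop_Suc)

lemmas computable_projections [computable_intros] =
  computable_hd
  computable_hd[THEN computable_tl]
  computable_hd[THEN computable_tl, THEN computable_tl]

lemma computable_Suc [computable_intros]:
  assumes "computable k a"
  shows "computable k (\<lambda>f xs. Suc (a f xs))"
proof -
  have "computable (Suc 0) (\<lambda>f xs. Suc (hd xs))"
    by (rule computableI[of _ Succ]) (auto simp: length_Suc_conv)
  from computable_comp1[OF this assms] show ?thesis .
qed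

lemma computable_const [computable_intros]: "computable k (\<lambda>f xs. c)"
proof (induction c)
  case 0
  show ?case by (rule computableI[of _ Zero]) simp
next
  case (Suc c)
  then show ?case by (rule computable_Suc)
qed

lemma computable_oracle [computable_intros]:
  assumes "computable k a"
  shows "computable k (\<lambda>f xs. f (a f xs))"
proof -
  have "computable (Suc 0) (\<lambda>f xs. f (hd xs))"
    by (rule computableI[of _ Oracle]) (auto simp: length_Suc_conv)
  from computable_comp1[OF this assms] show ?thesis .
qed

text \<open>Premises of binding rules access bound variables through \<open>hd\<close> and \<open>tl\<close>, so that the
  conclusions are higher-order patterns and the rules can be applied by resolution.\<close>

lemma computable_rec_nat [computable_intros]:
  assumes b: "computable k b" and a: "computable k a"
    and s: "computable (Suc (Suc k)) (\<lambda>f ys. s f (hd ys) (hd (tl ys)) (tl (tl ys)))"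
  shows "computable k (\<lambda>f xs. rec_nat (a f xs) (\<lambda>m r. s f m r xs) (b f xs))"
proof -
  obtain p where p: "\<And>f xs. length xs = k \<Longrightarrow> eval f p xs = Some (a f xs)"
    using a by (rule computableE) blast
  obtain q where q: "\<And>f ys. length ys = Suc (Suc k) \<Longrightarrow>
      eval f q ys = Some (s f (hd ys) (hd (tl ys)) (tl (tl ys)))"
    using s by (rule computableE) blast
  let ?R = "\<lambda>f ys. rec_nat (a f (tl ys)) (\<lambda>m r. s f m r (tl ys)) (hd ys)"
  have "eval f (PrimRec p q) (n # xs) = Some (?R f (n # xs))" if "length xs = k" for f n xs
    by (induction n) (simp_all add: p q that)
  then have "computable (Suc k) ?R"
    by (intro computableI[of _ "PrimRec p q"]) (auto simp only: length_Suc_conv)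
  from computable_subst_hd[OF this b] show ?thesis by simp
qed

lemma computable_add [computable_intros]:
  assumes "computable k a" "computable k b"
  shows "computable k (\<lambda>f xs. a f xs + b f xs)"
proof -
  have "m + n = rec_nat m (\<lambda>_ r. Suc r) n" for m n :: nat
    by (induction n) auto
  then have "computable (Suc (Suc 0)) (\<lambda>f xs. hd xs + hd (tl xs))"
    by (simp only:) (intro computable_intros)
  from computable_comp2[OF this assms] show ?thesis .
qed

lemma computable_mult [computable_intros]:
  assumes "computable k a" "computable k b"
  shows "computable k (\<lambda>f xs. a f xs * b f xs)"
proof -
  have "m * n = rec_nat 0 (\<lambda>_ r. r + m) n" for m n :: nat
    by (induction n) auto
  then have "computable (Suc (Suc 0)) (\<lambda>f xs. hd xs * hd (tl xs))"
    by (simp only:) (intro computable_intros)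
  from computable_comp2[OF this assms] show ?thesis .
qed

lemma computable_power [computable_intros]:
  assumes "computable k a" "computable k b"
  shows "computable k (\<lambda>f xs. a f xs ^ b f xs)"
proof -
  have "m ^ n = rec_nat 1 (\<lambda>_ r. m * r) n" for m n :: nat
    by (induction n) auto
  then have "computable (Suc (Suc 0)) (\<lambda>f xs. hd xs ^ hd (tl xs))"
    by (simp only:) (intro computable_intros)
  from computable_comp2[OF this assms] show ?thesis .
qed

lemma computable_pred:
  assumes "computable k a"
  shows "computable k (\<lambda>f xs. a f xs - 1)"
proof -
  have "n - 1 = rec_nat 0 (\<lambda>m _. m) n" for n :: nat
    by (induction n) auto
  then have "computable (Suc 0) (\<lambda>f xs. hd xs - 1)"
    by (simp only:) (intro computable_intros)
  from computable_comp1[OF this assms] show ?thesis .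
qed

lemma computable_diff [computable_intros]:
  assumes "computable k a" "computable k b"
  shows "computable k (\<lambda>f xs. a f xs - b f xs)"
proof -
  have "rec_nat m (\<lambda>_ r. r - 1) n = m - n" for m n :: nat
    by (induction n) auto
  moreover have "computable (Suc (Suc 0)) (\<lambda>f xs. rec_nat (hd xs) (\<lambda>_ r. r - 1) (hd (tl xs)))"
    by (intro computable_intros computable_pred)
  ultimately have "computable (Suc (Suc 0)) (\<lambda>f xs. hd xs - hd (tl xs))"
    by (simp only:)
  from computable_comp2[OF this assms] show ?thesis .
qed

lemma computable_sum [computable_intros]:
  assumes b: "computable k b" and s: "computable (Suc k) (\<lambda>f ys. s f (hd ys) (tl ys))"
  shows "computable k (\<lambda>f xs. \<Sum>z<b f xs. s f z xs)"
proof -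
  have "computable (Suc (Suc k)) (\<lambda>f ys. s f (hd ys) (tl (tl ys)))"
    using computable_subst[of "[\<lambda>f ys. hd ys]" k "\<lambda>f ys. s f (hd ys) (tl ys)" "Suc (Suc 0)"]
      s computable_hd
    by (simp add: drop_Suc)
  moreover have "(\<Sum>z<n. g z) = rec_nat 0 (\<lambda>m r. r + g m) n" for n :: nat and g :: "nat \<Rightarrow> nat"
    by (induction n) auto
  ultimately show ?thesis
    by (simp only:) (intro computable_intros b)
qed

lemma computable_prod_encode [computable_intros]:
  assumes "computable k a" "computable k b"
  shows "computable k (\<lambda>f xs. prod_encode (a f xs, b f xs))"
proof -
  have "triangle n = (\<Sum>i<n. Suc i)" for n
    by (induction n) auto
  then have "computable (Suc 0) (\<lambda>f xs. triangle (hd xs))"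
    by (simp only:) (intro computable_intros)
  note computable_triangle = computable_comp1[OF this]
  show ?thesis
    unfolding prod_encode_def prod.case by (intro computable_add computable_triangle assms)
qed

lemma decidable_le [computable_intros]:
  assumes "computable k a" "computable k b"
  shows "decidable k (\<lambda>f xs. a f xs \<le> b f xs)"
proof -
  have "of_bool (m \<le> n) = 1 - (m - n)" for m n :: nat
    by (cases "m \<le> n") auto
  then show ?thesis
    by (simp only:) (intro computable_intros assms)
qed

lemma decidable_less [computable_intros]:
  assumes "computable k a" "computable k b"
  shows "decidable k (\<lambda>f xs. a f xs < b f xs)"
  unfolding less_eq_Suc_le by (intro computable_intros assms)

lemma decidable_conj [computable_intros]:
  assumes "decidable k P" "decidable k Q"
  shows "decidable k (\<lambda>f xs. P f xs \<and> Q f xs)"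
  unfolding of_bool_conj by (intro computable_intros assms)

lemma decidable_not [computable_intros]:
  assumes "decidable k P"
  shows "decidable k (\<lambda>f xs. \<not> P f xs)"
proof -
  have "of_bool (\<not> p) = (1 :: nat) - of_bool p" for p
    by simp
  then show ?thesis
    by (simp only:) (intro computable_intros assms)
qed

lemma decidable_disj [computable_intros]:
  assumes "decidable k P" "decidable k Q"
  shows "decidable k (\<lambda>f xs. P f xs \<or> Q f xs)"
proof -
  have "p \<or> q \<longleftrightarrow> \<not> (\<not> p \<and> \<not> q)" for p q
    by blast
  then show ?thesis
    by (simp only:) (intro computable_intros assms)
qed

lemma decidable_imp [computable_intros]:
  assumes "decidable k P" "decidable k Q"
  shows "decidable k (\<lambda>f xs. P f xs \<longrightarrow> Q f xs)"
  unfolding imp_conv_disj by (intro computable_intros assms)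

lemma decidable_eq [computable_intros]:
  assumes "computable k a" "computable k b"
  shows "decidable k (\<lambda>f xs. a f xs = b f xs)"
  unfolding order_eq_iff by (intro computable_intros assms)

lemma decidable_ex_less [computable_intros]:
  assumes "computable k b" "decidable (Suc k) (\<lambda>f ys. P f (hd ys) (tl ys))"
  shows "decidable k (\<lambda>f xs. \<exists>z<b f xs. P f z xs)"
proof -
  have "(\<exists>z<n. p z) \<longleftrightarrow> 0 < (\<Sum>z<n. of_bool (p z) :: nat)" for n :: nat and p
    by (auto simp flip: neq0_conv)
  then show ?thesis
    by (simp only:) (intro computable_intros assms)
qed

lemma decidable_all_less [computable_intros]:
  assumes "computable k b" "decidable (Suc k) (\<lambda>f ys. P f (hd ys) (tl ys))"
  shows "decidable k (\<lambda>f xs. \<forall>z<b f xs. P f z xs)"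
proof -
  have "(\<forall>z<n. p z) \<longleftrightarrow> \<not> (\<exists>z<n. \<not> p z)" for n :: nat and p
    by blast
  then show ?thesis
    by (simp only:) (intro computable_intros assms)
qed

lemma power2_le_iff_le_floor_log:
  assumes "0 < n"
  shows "2 ^ k \<le> n \<longleftrightarrow> k \<le> floor_log n"
proof
  assume "2 ^ k \<le> n"
  from floor_log_le_iff[OF this] show "k \<le> floor_log n" by simp
next
  assume "k \<le> floor_log n"
  then have "(2 :: nat) ^ k \<le> 2 ^ floor_log n" by simp
  also have "\<dots> \<le> n" using assms by (rule floor_log_exp2_le)
  finally show "2 ^ k \<le> n" .
qed

lemma floor_log_eq_sum: "floor_log n = (\<Sum>k<n. of_bool (2 ^ Suc k \<le> n))"
proof (cases "n = 0")
  case False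
  have "floor_log n < 2 ^ floor_log n" by simp
  also have "\<dots> \<le> n" using False by (simp add: floor_log_exp2_le)
  finally have less: "floor_log n < n" .
  have "2 ^ Suc k \<le> n \<longleftrightarrow> k < floor_log n" for k
    using power2_le_iff_le_floor_log[of n "Suc k"] False unfolding Suc_le_eq by blast
  then have "(\<Sum>k<n. of_bool (2 ^ Suc k \<le> n)) = (\<Sum>k<n. of_bool (k < floor_log n) :: nat)"
    by presburger
  also have "\<dots> = card ({..<n} \<inter> {..<floor_log n})"
    by (simp add: lessThan_def)
  also have "\<dots> = floor_log n"
    using less by (simp add: Int_absorb1)
  finally show ?thesis ..
qed simp

lemma computable_floor_log [computable_intros]:
  assumes "computable k a"
  shows "computable k (\<lambda>f xs. floor_log (a f xs))"
proof -
  have "computable (Suc 0) (\<lambda>f xs. floor_log (hd xs))"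
    unfolding floor_log_eq_sum by (intro computable_intros)
  from computable_comp1[OF this assms] show ?thesis .
qed

lemma sW_reducible_if_computable:
  assumes \<Phi>: "computable (Suc 0) (\<lambda>f xs. \<Phi> f (hd xs))"
    and \<Psi>: "computable (Suc 0) (\<lambda>h xs. \<Psi> h (hd xs))"
    and dom: "\<And>f. f \<in> pdom F \<Longrightarrow> \<Phi> f \<in> pdom G"
    and sol: "\<And>f h. f \<in> pdom F \<Longrightarrow> h \<in> G (\<Phi> f) \<Longrightarrow> \<Psi> h \<in> F f"
  shows "F \<le>\<^sub>s\<^sub>W G"
proof -
  have functional: "turing_functional (\<lambda>f. Some \<circ> \<Theta> f)"
    if computable: "computable (Suc 0) (\<lambda>f xs. \<Theta> f (hd xs))" for \<Theta>
  proof -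
    obtain p where "\<And>f xs. length xs = Suc 0 \<Longrightarrow> eval f p xs = Some (\<Theta> f (hd xs))"
      using computable by (rule computableE) blast
    then show ?thesis
      unfolding turing_functional_def by (intro exI[of _ p]) simp
  qed
  show ?thesis
    unfolding sW_reducible_def using functional[OF \<Phi>] functional[OF \<Psi>] dom sol by blast
qed

section \<open>Solutions of a coded graph\<close>

lemma graph_code_eq_of_bool:
  "graph_code V E n = of_bool ((\<exists>m<Suc n. n = 2 * m \<and> m \<in> V) \<or>
    (\<exists>x<Suc n. \<exists>y<Suc n. n = Suc (2 * prod_encode (x, y)) \<and> {x, y} \<in> E))"
proof (cases "even n")
  case True
  then show ?thesis
    by (auto simp: graph_code_def join_def char_fun_def elim!: evenE) presburger
next
  case False
  then obtain m where n: "n = Suc (2 * m)"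
    by (metis oddE Suc_eq_plus1)
  have "x < Suc n" "y < Suc n" if "m = prod_encode (x, y)" for x y
    using le_prod_encode_1[of x y] le_prod_encode_2[of y x] that n by simp_all
  then show ?thesis
    by (auto simp: n graph_code_def join_def char_fun_def of_bool_eq_iff) presburger
qed

lemma computable_graph_code:
  assumes V: "decidable (Suc 0) (\<lambda>f xs. hd xs \<in> V f)"
    and E: "decidable (Suc (Suc 0)) (\<lambda>f xs. {hd xs, hd (tl xs)} \<in> E f)"
  shows "computable (Suc 0) (\<lambda>f xs. graph_code (V f) (E f) (hd xs))"
  unfolding graph_code_eq_of_bool
  by (intro computable_intros computable_comp1[OF V] computable_comp2[OF E])

lemma graph_code_inject:
  assumes "graph_code V E = graph_code V' E'"
  shows "V = V'" "nbhd E = nbhd E'"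
proof -
  have "v \<in> V \<longleftrightarrow> v \<in> V'" for v
    using fun_cong[OF assms, of "2 * v"]
    by (simp add: graph_code_def join_def char_fun_def of_bool_eq_iff)
  then show "V = V'" by blast
  have "{x, y} \<in> E \<longleftrightarrow> {x, y} \<in> E'" for x y
    using fun_cong[OF assms, of "Suc (2 * prod_encode (x, y))"]
    by (simp add: graph_code_def join_def char_fun_def of_bool_eq_iff)
  then show "nbhd E = nbhd E'"
    by (simp add: nbhd_def fun_eq_iff)
qed

definition wRSg_solution :: "('a \<Rightarrow> 'a set) \<Rightarrow> 'a set \<Rightarrow> bool" where
  "wRSg_solution N S \<longleftrightarrow> infinite S \<and> (\<forall>v\<in>S. infinite (S \<inter> N v) \<or> card (S \<inter> N v) \<le> 1)"

lemma wRSg_solution_cong: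
  assumes "\<And>v. v \<in> S \<Longrightarrow> S \<inter> N v = S \<inter> N' v"
  shows "wRSg_solution N S \<longleftrightarrow> wRSg_solution N' S"
  using assms by (simp add: wRSg_solution_def)

lemma wRSg_graph_code:
  assumes "inf_graph V E"
  shows "wRSg (graph_code V E) = char_fun ` {H. H \<subseteq> V \<and> wRSg_solution (nbhd E) H}"
proof (intro equalityI subsetI)
  fix h assume "h \<in> wRSg (graph_code V E)"
  then obtain H V' E' where code: "graph_code V E = graph_code V' E'"
    and H: "h = char_fun H" "H \<subseteq> V'" "wRSg_solution (nbhd E') H"
    unfolding wRSg_def wRSg_solution_def by blast
  from H show "h \<in> char_fun ` {H. H \<subseteq> V \<and> wRSg_solution (nbhd E) H}"
    unfolding graph_code_inject[OF code] by blast
next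
  fix h assume "h \<in> char_fun ` {H. H \<subseteq> V \<and> wRSg_solution (nbhd E) H}"
  then show "h \<in> wRSg (graph_code V E)"
    using assms unfolding wRSg_def wRSg_solution_def by blast
qed

lemma wRSg_solution_exists:
  assumes "inf_graph V E"
  obtains H where "H \<subseteq> V" "wRSg_solution (nbhd E) H"
proof -
  have loop: "{v} \<notin> E" for v
    using assms by (auto simp: inf_graph_def nsets_def)
  have "infinite V"
    using assms by (simp add: inf_graph_def)
  moreover have "\<forall>x\<in>V. \<forall>y\<in>V. x \<noteq> y \<longrightarrow> of_bool ({x, y} \<in> E) < (2 :: nat)"
    by (simp add: of_bool_def)
  ultimately obtain H t where H: "H \<subseteq> V" "infinite H"
    and homogeneous: "\<forall>x\<in>H. \<forall>y\<in>H. x \<noteq> y \<longrightarrow> of_bool ({x, y} \<in> E) = (t :: nat)"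
    using Ramsey2[of V "\<lambda>e. of_bool (e \<in> E)" 2] by blast
  have "infinite (H \<inter> nbhd E v) \<or> card (H \<inter> nbhd E v) \<le> 1" if v: "v \<in> H" for v
  proof (cases "t = 0")
    case True
    then have "{v, y} \<notin> E" if "y \<in> H" for y
      using homogeneous v loop[of v] that by (cases "y = v") auto
    then have "H \<inter> nbhd E v = {}"
      by (auto simp: nbhd_def)
    then show ?thesis by simp
  next
    case False
    then have "H - {v} \<subseteq> H \<inter> nbhd E v"
      using homogeneous v by (fastforce simp: nbhd_def)
    then show ?thesis
      using H(2) by (meson finite_Diff2 finite_subset finite.intros)
  qed
  with H that show ?thesis
    by (simp add: wRSg_solution_def)
qed

lemma graph_code_in_pdom_wRSg:
  assumes "inf_graph V E"
  shows "graph_code V E \<in> pdom wRSg"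
  using wRSg_solution_exists[OF assms] by (auto simp: pdom_def wRSg_graph_code[OF assms])

definition increasing_pairs :: "(nat \<Rightarrow> 'a::linorder) \<Rightarrow> nat set \<Rightarrow> nat set set" where
  "increasing_pairs r V = {{u, v} | u v. u \<in> V \<and> v \<in> V \<and> u < v \<and> r u < r v}"

lemma doubleton_in_increasing_pairs:
  "{u, v} \<in> increasing_pairs r V \<longleftrightarrow> u \<in> V \<and> v \<in> V \<and> (u < v \<and> r u < r v \<or> v < u \<and> r v < r u)"
  by (auto simp: increasing_pairs_def doubleton_eq_iff)

lemma inf_graph_increasing_pairs: "infinite V \<Longrightarrow> inf_graph V (increasing_pairs r V)"
  by (auto simp: inf_graph_def increasing_pairs_def)

definition increasing_nbrs :: "(nat \<Rightarrow> 'a::linorder) \<Rightarrow> nat \<Rightarrow> nat set" where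
  "increasing_nbrs r x = {y. x < y \<and> r x < r y \<or> y < x \<and> r y < r x}"

lemma wRSg_increasing_pairs:
  assumes "infinite V"
  shows "wRSg (graph_code V (increasing_pairs r V)) =
    char_fun ` {H. H \<subseteq> V \<and> wRSg_solution (increasing_nbrs r) H}"
proof -
  have "wRSg_solution (nbhd (increasing_pairs r V)) H \<longleftrightarrow> wRSg_solution (increasing_nbrs r) H"
    if "H \<subseteq> V" for H
    using that
    by (intro wRSg_solution_cong)
      (auto simp: nbhd_def increasing_nbrs_def doubleton_in_increasing_pairs)
  then show ?thesis
    using wRSg_graph_code[OF inf_graph_increasing_pairs[OF assms]] by auto
qed

lemma decidable_increasing_pairs:
  assumes V: "decidable (Suc 0) (\<lambda>f xs. hd xs \<in> V f)"
    and r: "decidable (Suc (Suc 0)) (\<lambda>f xs. r f (hd xs) < r f (hd (tl xs)))"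
  shows "decidable (Suc (Suc 0)) (\<lambda>f xs. {hd xs, hd (tl xs)} \<in> increasing_pairs (r f) (V f))"
  unfolding doubleton_in_increasing_pairs
  by (intro computable_intros computable_comp1[OF V] computable_comp2[OF r])

section \<open>Eventual constancy along a set\<close>

definition along :: "'a set \<Rightarrow> 'a filter" where
  "along S = inf cofinite (principal S)"

lemma eventually_along: "eventually P (along S) \<longleftrightarrow> finite {x \<in> S. \<not> P x}"
  by (simp add: along_def eventually_inf_principal eventually_cofinite)

lemma eventually_alongI: "(\<And>x. x \<in> S \<Longrightarrow> P x) \<Longrightarrow> \<forall>\<^sub>F x in along S. P x"
  by (simp add: along_def eventually_inf_principal)

lemma eventually_constant_if_eventually_related:
  assumes fin: "finite (range g)" and "antisymp R"
    and rel: "\<forall>\<^sub>F y in F. \<forall>\<^sub>F z in F. R (g y) (g z)"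
  shows "\<exists>c. \<forall>\<^sub>F x in F. g x = c"
proof -
  let ?recurs = "\<lambda>c. \<exists>\<^sub>F x in F. g x = c"
  have related: "R c c'" if "?recurs c" "?recurs c'" for c c'
  proof -
    have "\<exists>\<^sub>F y in F. (\<forall>\<^sub>F z in F. R (g y) (g z)) \<and> g y = c"
      using that(1) rel by (rule frequently_eventually_conj)
    then have "\<forall>\<^sub>F z in F. R c (g z)"
      by (auto dest: frequently_ex)
    with that(2) have "\<exists>\<^sub>F z in F. R c (g z) \<and> g z = c'"
      by (rule frequently_eventually_conj)
    then show ?thesis
      by (auto dest: frequently_ex)
  qed
  have "\<forall>\<^sub>F x in F. \<forall>c\<in>range g. \<not> ?recurs c \<longrightarrow> g x \<noteq> c"
    using fin by (intro eventually_ball_finite) (auto simp: not_frequently eventually_mono)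
  then have recurs: "\<forall>\<^sub>F x in F. ?recurs (g x)"
    by (rule eventually_mono) blast
  obtain c where "\<And>c'. ?recurs c' \<Longrightarrow> c' = c"
    using related \<open>antisymp R\<close> by (metis antisympD)
  then show ?thesis
    using eventually_mono[OF recurs, of "\<lambda>x. g x = c"] by blast
qed

lemma eventually_along_imageI:
  assumes "\<forall>\<^sub>F x in along S. P (f x)"
  shows "\<forall>\<^sub>F y in along (f ` S). P y"
proof -
  have "{y \<in> f ` S. \<not> P y} \<subseteq> f ` {x \<in> S. \<not> P (f x)}"
    by blast
  then show ?thesis
    using assms unfolding eventually_along by (meson finite_imageI finite_subset)
qed

section \<open>Thinning a solution\<close>

definition hub :: "nat set \<Rightarrow> (nat \<Rightarrow> 'a::linorder) \<Rightarrow> nat \<Rightarrow> bool" where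
  "hub S r d \<longleftrightarrow> d \<in> S \<and> (\<exists>a<d. \<exists>b<a. a \<in> S \<and> b \<in> S \<and> r a < r d \<and> r b < r d)"

definition thin :: "nat set \<Rightarrow> (nat \<Rightarrow> 'a::linorder) \<Rightarrow> nat set" where
  "thin S r = {y \<in> S. \<forall>z<y. z \<in> S \<and> (\<exists>d\<le>z. hub S r d) \<longrightarrow> r z < r y}"

lemma thin_subset: "thin S r \<subseteq> S"
  by (auto simp: thin_def)

lemma thin_eq_if_no_hub: "(\<And>d. \<not> hub S r d) \<Longrightarrow> thin S r = S"
  by (auto simp: thin_def)

lemma infinite_nbrsE:
  assumes "infinite (S \<inter> increasing_nbrs r x)"
  obtains y where "y \<in> S" "n < y" "x < y" "r x < r y"
proof -
  obtain y where "y \<in> S \<inter> increasing_nbrs r x" "max n x < y"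
    using assms unfolding infinite_nat_iff_unbounded by blast
  then show ?thesis
    using that by (auto simp: increasing_nbrs_def)
qed

lemma hub_if_infinite_nbrs:
  assumes "x \<in> S" "y \<in> S" "x < y"
    and "infinite (S \<inter> increasing_nbrs r x)" "infinite (S \<inter> increasing_nbrs r y)"
  shows "\<exists>d. hub S r d"
proof -
  obtain m where m: "infinite (S \<inter> increasing_nbrs r m)" "r x \<le> r m" "r y \<le> r m"
    using assms(4,5) by (meson linear order_refl)
  obtain d where "d \<in> S" "y < d" "r m < r d"
    using infinite_nbrsE[OF m(1)] by blast
  with assms(1-3) m(2,3) have "hub S r d"
    unfolding hub_def by (meson order.strict_trans order.strict_trans1)
  then show ?thesis ..
qed

lemma eventually_decreasing_if_no_hub:
  assumes "\<And>d. \<not> hub S r d"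
  shows "\<forall>\<^sub>F y in along S. \<forall>\<^sub>F z in along S. r z \<le> r y"
proof -
  define I where "I = {x \<in> S. infinite (S \<inter> increasing_nbrs r x)}"
  have "finite I"
  proof (rule ccontr)
    assume "infinite I"
    then obtain x y where "x \<in> I" "y \<in> I" "x < y"
      by (meson infinite_nat_iff_unbounded)
    then show False
      using hub_if_infinite_nbrs[of x S y r] assms by (auto simp: I_def)
  qed
  moreover have "{y \<in> S. infinite {z \<in> S. \<not> r z \<le> r y}} \<subseteq> I"
  proof -
    have "{z \<in> S. \<not> r z \<le> r y} \<subseteq> {..y} \<union> (S \<inter> increasing_nbrs r y)" for y
      by (auto simp: increasing_nbrs_def)
    then have "finite {z \<in> S. \<not> r z \<le> r y}" if "finite (S \<inter> increasing_nbrs r y)" for y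
      using that by (meson finite_Un finite_atMost finite_subset)
    then show ?thesis by (auto simp: I_def)
  qed
  ultimately show ?thesis
    unfolding eventually_along by (rule rev_finite_subset)
qed

lemma eventually_increasing_along_thin:
  assumes "hub S r d"
  shows "\<forall>\<^sub>F y in along (thin S r). \<forall>\<^sub>F z in along (thin S r). r y \<le> r z"
proof -
  have "{z \<in> thin S r. \<not> r y \<le> r z} \<subseteq> {..y}" if "y \<in> thin S r" "d \<le> y" for y
    using assms that unfolding thin_def by (auto simp: not_le[symmetric] less_imp_le)
  then have "finite {z \<in> thin S r. \<not> r y \<le> r z}" if "y \<in> thin S r" "d \<le> y" for y
    using that by (meson finite_atMost finite_subset)
  then have "{y \<in> thin S r. infinite {z \<in> thin S r. \<not> r y \<le> r z}} \<subseteq> {..<d}"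
    by (auto simp: not_le[symmetric])
  then show ?thesis
    unfolding eventually_along by (rule finite_subset) simp
qed

lemma infinite_nbrs_if_hub:
  assumes "wRSg_solution (increasing_nbrs r) S" "hub S r d"
  shows "infinite (S \<inter> increasing_nbrs r d)"
proof
  assume fin: "finite (S \<inter> increasing_nbrs r d)"
  obtain a b where ab: "a \<in> S" "b \<in> S" "b < a" "a < d" "r a < r d" "r b < r d"
    using assms(2) unfolding hub_def by blast
  then have "card {a, b} \<le> card (S \<inter> increasing_nbrs r d)"
    by (intro card_mono fin) (auto simp: increasing_nbrs_def)
  with ab assms fin show False
    by (auto simp: wRSg_solution_def hub_def)
qed

lemma hub_if_above_hub:
  assumes "hub S r d" "x \<in> S" "d < x" "r d < r x"
  shows "hub S r x"
  using assms unfolding hub_def by (meson order.strict_trans)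

lemma first_hub_in_thin:
  assumes "hub S r d" "\<And>e. hub S r e \<Longrightarrow> d \<le> e"
  shows "d \<in> thin S r"
  using assms by (fastforce simp: thin_def hub_def[of S r d])

lemma thin_contains_next_record:
  assumes x: "x \<in> thin S r" and inf: "infinite (S \<inter> increasing_nbrs r x)"
  obtains y where "y \<in> thin S r" "x < y" "r x < r y"
proof -
  let ?P = "\<lambda>y. y \<in> S \<and> x < y \<and> r x < r y"
  define y where "y = (LEAST y. ?P y)"
  have "\<exists>y. ?P y"
    using infinite_nbrsE[OF inf] by metis
  then have y: "y \<in> S" "x < y" "r x < r y"
    unfolding y_def by (metis (mono_tags, lifting) LeastI_ex)+
  have "r z < r y" if "z \<in> S" "z < y" and hub: "\<exists>d\<le>z. hub S r d" for z
  proof (cases "z < x")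
    case True
    then have "r z < r x"
      using x \<open>z \<in> S\<close> hub unfolding thin_def by blast
    then show ?thesis using y(3) by simp
  next
    case False
    have "\<not> ?P z"
      using \<open>z < y\<close> unfolding y_def by (rule not_less_Least)
    then have "r z \<le> r x"
      using False \<open>z \<in> S\<close> by (cases "z = x") auto
    then show ?thesis using y(3) by simp
  qed
  with y that show ?thesis
    unfolding thin_def by blast
qed

lemma infinite_thin:
  assumes sol: "wRSg_solution (increasing_nbrs r) S"
  shows "infinite (thin S r)"
proof (cases "\<exists>d. hub S r d")
  case True
  let ?T = "{x \<in> thin S r. hub S r x}"
  define d where "d = (LEAST d. hub S r d)"
  have "d \<in> ?T"
    using True by (auto simp: d_def intro: LeastI_ex Least_le first_hub_in_thin)
  moreover have "\<exists>y\<in>?T. x < y" if x: "x \<in> ?T" for x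
  proof -
    obtain y where "y \<in> thin S r" "x < y" "r x < r y"
      using x infinite_nbrs_if_hub[OF sol] by (auto elim: thin_contains_next_record)
    moreover from this have "hub S r y"
      using x thin_subset[of S r] by (blast intro: hub_if_above_hub)
    ultimately show ?thesis by blast
  qed
  ultimately have "infinite ?T"
    by (intro infinite_growing) auto
  then show ?thesis
    by (rule infinite_super[rotated]) blast
next
  case False
  then show ?thesis
    using sol by (simp add: thin_eq_if_no_hub wRSg_solution_def)
qed

lemma eventually_constant_along_thin:
  fixes \<phi> :: "'a::linorder \<Rightarrow> 'b::order"
  assumes "mono \<phi>" and fin: "finite (range (\<lambda>x. \<phi> (r x)))"
  shows "\<exists>c. \<forall>\<^sub>F x in along (thin S r). \<phi> (r x) = c"
proof (cases "\<exists>d. hub S r d")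
  case True
  then have "\<forall>\<^sub>F y in along (thin S r). \<forall>\<^sub>F z in along (thin S r). \<phi> (r y) \<le> \<phi> (r z)"
    using eventually_increasing_along_thin[of S r] \<open>mono \<phi>\<close>
    by (blast intro: eventually_mono dest: monoD)
  then show ?thesis
    by (intro eventually_constant_if_eventually_related[OF fin]) auto
next
  case False
  then have "\<forall>\<^sub>F y in along S. \<forall>\<^sub>F z in along S. \<phi> (r z) \<le> \<phi> (r y)"
    using eventually_decreasing_if_no_hub[of S r] \<open>mono \<phi>\<close>
    by (blast intro: eventually_mono dest: monoD)
  then show ?thesis
    using False by (intro eventually_constant_if_eventually_related[OF fin, where R = "(\<ge>)"])
      (auto simp: thin_eq_if_no_hub)
qed

lemma decidable_thin:
  assumes S: "decidable (Suc 0) (\<lambda>f xs. hd xs \<in> S f)"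
    and r: "decidable (Suc (Suc 0)) (\<lambda>f xs. r f (hd xs) < r f (hd (tl xs)))"
  shows "decidable (Suc 0) (\<lambda>f xs. hd xs \<in> thin (S f) (r f))"
  unfolding thin_def hub_def mem_Collect_eq less_Suc_eq_le[symmetric]
  by (intro computable_intros computable_comp1[OF S] computable_comp2[OF r])

section \<open>Binary numerals\<close>

definition significand :: "nat \<Rightarrow> real" where
  "significand n = n / 2 ^ floor_log n"

lemma significand_less_iff:
  "significand m < significand n \<longleftrightarrow> m * 2 ^ floor_log n < n * 2 ^ floor_log m"
proof -
  have "significand m < significand n \<longleftrightarrow> real (m * 2 ^ floor_log n) < real (n * 2 ^ floor_log m)"
    by (simp add: significand_def field_simps)
  then show ?thesis
    unfolding of_nat_less_iff .
qed

lemma significand_nonneg: "0 \<le> significand n"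
  by (simp add: significand_def)

lemma significand_less_2: "significand n < 2"
proof -
  have "real n < real (2 * 2 ^ floor_log n)"
    unfolding of_nat_less_iff by (rule floor_log_exp2_gt)
  then show ?thesis
    by (simp add: significand_def field_simps)
qed

lemma mono_floor_mult: "0 \<le> c \<Longrightarrow> mono (\<lambda>q::real. \<lfloor>c * q\<rfloor>)"
  by (intro monoI floor_mono mult_left_mono)

lemma finite_range_floor_significand: "finite (range (\<lambda>n. \<lfloor>2 ^ i * significand n\<rfloor>))"
proof -
  have "range (\<lambda>n. \<lfloor>2 ^ i * significand n\<rfloor>) \<subseteq> {0..<2 ^ i * 2}"
    using significand_less_2 by (auto simp: floor_less_iff significand_nonneg)
  then show ?thesis
    by (rule finite_subset) simp
qed

primrec membership_code :: "(nat \<Rightarrow> nat set) \<Rightarrow> nat \<Rightarrow> nat \<Rightarrow> nat" where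
  "membership_code A x 0 = 1"
| "membership_code A x (Suc i) = 2 * membership_code A x i + of_bool (x \<in> A i)"

lemma membership_code_bounds:
  "2 ^ i \<le> membership_code A x i" "membership_code A x i < 2 * 2 ^ i"
  by (induction i) auto

lemma membership_code_div: "membership_code A x (i + j) div 2 ^ j = membership_code A x i"
proof (induction j)
  case (Suc j)
  have "membership_code A x (i + Suc j) div 2 ^ Suc j = membership_code A x (i + j) div 2 ^ j"
    by (simp add: div_mult2_eq)
  with Suc show ?case by simp
qed simp

definition vertex :: "(nat \<Rightarrow> nat set) \<Rightarrow> nat \<Rightarrow> nat" where
  "vertex A x = membership_code A x x"

lemma floor_log_vertex: "floor_log (vertex A x) = x"
  using membership_code_bounds[where A = A and x = x and i = x]
  by (intro floor_log_eqI) (auto simp: vertex_def)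

lemma infinite_range_vertex: "infinite (range (vertex A))"
  using floor_log_vertex by (metis injI range_inj_infinite)

lemma mem_range_vertex_iff: "v \<in> range (vertex A) \<longleftrightarrow> v = vertex A (floor_log v)"
  using floor_log_vertex by auto

lemma floor_significand_vertex:
  assumes "i \<le> x"
  shows "\<lfloor>2 ^ i * significand (vertex A x)\<rfloor> = int (membership_code A x i)"
proof -
  have "2 ^ i * significand (vertex A x) = real (vertex A x) / real (2 ^ (x - i))"
    using assms by (simp add: significand_def floor_log_vertex field_simps flip: power_add)
  also have "\<lfloor>\<dots>\<rfloor> = int (vertex A x div 2 ^ (x - i))"
    by (rule floor_divide_of_nat_eq)
  also have "vertex A x div 2 ^ (x - i) = membership_code A x i"
    using membership_code_div[of A x i "x - i"] assms by (simp add: vertex_def)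
  finally show ?thesis .
qed

lemma mem_iff_odd_floor_significand:
  assumes "i < x"
  shows "x \<in> A i \<longleftrightarrow> odd \<lfloor>2 ^ Suc i * significand (vertex A x)\<rfloor>"
  using floor_significand_vertex[of "Suc i" x A] assms by simp

section \<open>The reduction\<close>

definition cohesive :: "(nat \<Rightarrow> nat set) \<Rightarrow> nat set \<Rightarrow> bool" where
  "cohesive A C \<longleftrightarrow> infinite C \<and> (\<forall>i. finite (C - A i) \<or> finite (C \<inter> A i))"

definition digit_graph_code :: "(nat \<Rightarrow> nat set) \<Rightarrow> nat \<Rightarrow> nat" where
  "digit_graph_code A =
    graph_code (range (vertex A)) (increasing_pairs significand (range (vertex A)))"

lemma digit_graph_code_in_pdom_wRSg: "digit_graph_code A \<in> pdom wRSg"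
  unfolding digit_graph_code_def
  by (intro graph_code_in_pdom_wRSg inf_graph_increasing_pairs infinite_range_vertex)

definition cohesive_part :: "nat set \<Rightarrow> nat set" where
  "cohesive_part H = floor_log ` thin H significand"

lemma eventually_mem_iff_along_cohesive_part:
  assumes V: "H \<subseteq> range (vertex A)"
  shows "\<exists>b. \<forall>\<^sub>F x in along (cohesive_part H). x \<in> A i \<longleftrightarrow> b"
proof -
  let ?T = "thin H significand"
  have "\<forall>\<^sub>F v in along ?T. v = vertex A (floor_log v)"
    using V thin_subset mem_range_vertex_iff by (intro eventually_alongI) blast
  moreover have "\<forall>\<^sub>F v in along ?T. i < floor_log v"
  proof -
    have "v < 2 * 2 ^ i" if "floor_log v \<le> i" for v
    proof -
      have "v < 2 * 2 ^ floor_log v" by (rule floor_log_exp2_gt)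
      also have "\<dots> \<le> 2 * 2 ^ i" using that by simp
      finally show ?thesis .
    qed
    then have "{v \<in> ?T. \<not> i < floor_log v} \<subseteq> {..<2 * 2 ^ i}"
      by auto
    then show ?thesis
      unfolding eventually_along by (rule finite_subset) simp
  qed
  moreover obtain c where "\<forall>\<^sub>F v in along ?T. \<lfloor>2 ^ Suc i * significand v\<rfloor> = c"
    using eventually_constant_along_thin[OF mono_floor_mult finite_range_floor_significand]
    by (metis zero_le_numeral zero_le_power)
  ultimately have "\<forall>\<^sub>F v in along ?T. floor_log v \<in> A i \<longleftrightarrow> odd c"
    by eventually_elim (metis mem_iff_odd_floor_significand)
  then show ?thesis
    unfolding cohesive_part_def by (blast intro: eventually_along_imageI)
qed

lemma infinite_cohesive_part:
  assumes V: "H \<subseteq> range (vertex A)" and sol: "wRSg_solution (increasing_nbrs significand) H"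
  shows "infinite (cohesive_part H)"
proof -
  have "infinite (thin H significand)"
    using sol by (rule infinite_thin)
  moreover have "inj_on floor_log (thin H significand)"
    using V thin_subset[of H significand] mem_range_vertex_iff by (metis inj_onI subsetD)
  ultimately show ?thesis
    by (simp add: cohesive_part_def finite_image_iff)
qed

lemma cohesive_cohesive_part:
  assumes "H \<subseteq> range (vertex A)" "wRSg_solution (increasing_nbrs significand) H"
  shows "cohesive A (cohesive_part H)"
  unfolding cohesive_def
proof (intro conjI allI)
  show "infinite (cohesive_part H)"
    using assms by (rule infinite_cohesive_part)
next
  fix i
  obtain b where "\<forall>\<^sub>F x in along (cohesive_part H). x \<in> A i \<longleftrightarrow> b"
    using eventually_mem_iff_along_cohesive_part[OF assms(1)] by blast
  then show "finite (cohesive_part H - A i) \<or> finite (cohesive_part H \<inter> A i)"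
    by (cases b) (simp_all add: eventually_along set_diff_eq Int_def)
qed

definition columns :: "(nat \<Rightarrow> nat) \<Rightarrow> nat \<Rightarrow> nat set" where
  "columns f i = {x. 0 < f (prod_encode (i, x))}"

definition support :: "(nat \<Rightarrow> nat) \<Rightarrow> nat set" where
  "support h = {n. 0 < h n}"

lemma columns_seq_code: "columns (seq_code A) = A"
  by (auto simp: columns_def seq_code_def char_fun_def fun_eq_iff)

lemma support_char_fun: "support (char_fun A) = A"
  by (simp add: support_def char_fun_def)

lemma pdom_COH_E:
  assumes "f \<in> pdom COH"
  obtains A where "f = seq_code A"
  using assms by (auto simp: pdom_def COH_def)

lemma char_fun_in_COH: "cohesive A C \<Longrightarrow> char_fun C \<in> COH (seq_code A)"
  by (auto simp: COH_def cohesive_def)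

lemma decidable_columns [computable_intros]:
  assumes "computable k a" "computable k b"
  shows "decidable k (\<lambda>f xs. a f xs \<in> columns f (b f xs))"
  unfolding columns_def mem_Collect_eq by (intro computable_intros assms)

lemma decidable_support [computable_intros]:
  assumes "computable k a"
  shows "decidable k (\<lambda>f xs. a f xs \<in> support f)"
  unfolding support_def mem_Collect_eq by (intro computable_intros assms)

lemma computable_vertex_columns [computable_intros]:
  assumes "computable k a"
  shows "computable k (\<lambda>f xs. vertex (columns f) (a f xs))"
proof -
  have "membership_code A x i = rec_nat 1 (\<lambda>m r. 2 * r + of_bool (x \<in> A m)) i" for A x i
    by (induction i) auto
  then have "computable (Suc 0) (\<lambda>f xs. vertex (columns f) (hd xs))"
    unfolding vertex_def by (simp only:) (intro computable_intros)
  from computable_comp1[OF this assms] show ?thesis .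
qed

lemma decidable_significand_less [computable_intros]:
  assumes "computable k a" "computable k b"
  shows "decidable k (\<lambda>f xs. significand (a f xs) < significand (b f xs))"
  unfolding significand_less_iff by (intro computable_intros assms)

lemma computable_digit_graph_code:
  "computable (Suc 0) (\<lambda>f xs. digit_graph_code (columns f) (hd xs))"
proof -
  have V: "decidable (Suc 0) (\<lambda>f xs. hd xs \<in> range (vertex (columns f)))"
    unfolding mem_range_vertex_iff by (intro computable_intros)
  have "decidable (Suc (Suc 0)) (\<lambda>f xs.
      {hd xs, hd (tl xs)} \<in> increasing_pairs significand (range (vertex (columns f))))"
    using V by (rule decidable_increasing_pairs) (intro computable_intros)
  with V show ?thesis
    unfolding digit_graph_code_def by (rule computable_graph_code)
qed

lemma mem_cohesive_part_iff:
  "x \<in> cohesive_part H \<longleftrightarrow> (\<exists>v<2 * 2 ^ x. v \<in> thin H significand \<and> floor_log v = x)"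
  unfolding cohesive_part_def using floor_log_exp2_gt by blast

lemma computable_cohesive_part:
  "computable (Suc 0) (\<lambda>h xs. char_fun (cohesive_part (support h)) (hd xs))"
proof -
  have "decidable (Suc 0) (\<lambda>h xs. hd xs \<in> thin (support h) significand)"
    by (rule decidable_thin) (intro computable_intros)+
  note decidable_mem_thin = computable_comp1[OF this]
  show ?thesis
    unfolding char_fun_def mem_cohesive_part_iff by (intro computable_intros decidable_mem_thin)
qed

theorem theorem6p9: "COH \<le>\<^sub>s\<^sub>W wRSg"
proof (rule sW_reducible_if_computable[OF computable_digit_graph_code computable_cohesive_part])
  show "digit_graph_code (columns f) \<in> pdom wRSg" for f
    by (rule digit_graph_code_in_pdom_wRSg)
next
  fix f h
  assume "f \<in> pdom COH"
  then obtain A where f: "f = seq_code A"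
    by (rule pdom_COH_E)
  assume "h \<in> wRSg (digit_graph_code (columns f))"
  then obtain H where h: "h = char_fun H"
    and H: "H \<subseteq> range (vertex A)" "wRSg_solution (increasing_nbrs significand) H"
    by (auto simp: f columns_seq_code digit_graph_code_def
        wRSg_increasing_pairs[OF infinite_range_vertex])
  from H have "cohesive A (cohesive_part H)"
    by (rule cohesive_cohesive_part)
  then show "char_fun (cohesive_part (support h)) \<in> COH f"
    by (simp add: f h support_char_fun char_fun_in_COH)
qed

end
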